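(* There exists a chain of length $\aleph_1$ of $\approx$-classes containing (not necessarily closed) subsemigroups of $\mathfrak{F}_2$; that is, there exist subsemigroups $S_\alpha$ ($\alpha<\aleph_1$) of $\mathfrak{F}_2$ such that $S_\alpha\prec S_\beta$ for all ordinals $\alpha<\beta<\aleph_1$.
   Context: $\mathbb{N}=\{0,1,2,\ldots\}$ and $\mathbb{N}^\mathbb{N}$ is the semigroup of all maps $\mathbb{N}\to\mathbb{N}$ under composition. $\mathfrak{F}_2=\{f\in\mathbb{N}^\mathbb{N}: |f(\mathbb{N})|\leq 2\}$. For $U,V\subseteq\mathbb{N}^\mathbb{N}$, $U\preccurlyeq V$ means there is a countable $C\subseteq\mathbb{N}^\mathbb{N}$ such that $U$ is contained in the subsemigroup generated by $V\cup C$; $U\approx V$ means $U\preccurlyeq V$ and $V\preccurlyeq U$; $U\prec V$ means $U\preccurlyeq V$ and not $U\approx V$. *)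

theory Defs
  imports Main "HOL-Library.Countable_Set"
begin

definition F2 :: "(nat \<Rightarrow> nat) set" where
  "F2 = {f. finite (range f) \<and> card (range f) \<le> 2}"

text \<open>Subsemigroups are nonempty, as usual.\<close>

definition subsemigroup :: "(nat \<Rightarrow> nat) set \<Rightarrow> bool" where
  "subsemigroup S \<longleftrightarrow> S \<noteq> {} \<and> (\<forall>f\<in>S. \<forall>g\<in>S. f \<circ> g \<in> S)"

inductive_set semigroup_gen :: "(nat \<Rightarrow> nat) set \<Rightarrow> (nat \<Rightarrow> nat) set"
  for A :: "(nat \<Rightarrow> nat) set" where
  gen_base: "f \<in> A \<Longrightarrow> f \<in> semigroup_gen A"
| gen_comp: "f \<in> semigroup_gen A \<Longrightarrow> g \<in> semigroup_gen A \<Longrightarrow> f \<circ> g \<in> semigroup_gen A"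

definition preceq :: "(nat \<Rightarrow> nat) set \<Rightarrow> (nat \<Rightarrow> nat) set \<Rightarrow> bool" where
  "preceq U V \<longleftrightarrow> (\<exists>C. countable C \<and> U \<subseteq> semigroup_gen (V \<union> C))"

definition approx :: "(nat \<Rightarrow> nat) set \<Rightarrow> (nat \<Rightarrow> nat) set \<Rightarrow> bool" where
  "approx U V \<longleftrightarrow> preceq U V \<and> preceq V U"

definition strict_prec :: "(nat \<Rightarrow> nat) set \<Rightarrow> (nat \<Rightarrow> nat) set \<Rightarrow> bool" where
  "strict_prec U V \<longleftrightarrow> preceq U V \<and> \<not> approx U V"

text \<open>The ordinal \<open>\<aleph>\<^sub>1\<close>, as a reflexive well-order: the library's successor cardinal of
  the order of the natural numbers.  The ordinals below \<open>\<aleph>\<^sub>1\<close> correspond to the elements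
  of its field, and \<open>\<alpha> < \<beta>\<close> to \<open>(\<alpha>, \<beta>) \<in> aleph1\<close> with \<open>\<alpha> \<noteq> \<beta>\<close>.\<close>

definition aleph1 :: "nat set rel" where
  "aleph1 = cardSuc natLeq"

end

theory Submission
  imports Defs "HOL-Library.Nat_Bijection"
begin

unbundle cardinal_syntax

text \<open>Let \<open>branch x\<close>, for \<open>x\<close> a set of natural numbers, be an almost disjoint family
  of infinite sets.  If a characteristic function \<open>chi (branch x)\<close> is generated by other such
  functions together with a countable set, then it lies in a fixed countable monoid \<open>M\<close>, or else
  \<open>branch x\<close> or its complement is the preimage of some \<open>branch y\<close> under a member of \<open>M\<close>.
  If a set is the preimage under \<open>c\<close> of two almost disjoint sets, then it is the preimage of their
  finite intersection, and only countably many sets arise in this way.  So, apart from countably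
  many \<open>x\<close>, the relation between \<open>x\<close> and \<open>y\<close> has countable sections in both
  directions.  A transfinite recursion over all pairs of a level and a countable monoid then picks
  for each pair an \<open>x\<close> such that the sections at the chosen points are pairwise disjoint.  Each
  section gets the level of its pair, and \<open>S \<alpha>\<close> consists of the characteristic functions of
  level at most \<open>\<alpha>\<close>: the \<open>x\<close> chosen for \<open>(\<beta>, M)\<close> witnesses that \<open>M\<close> does not
  generate \<open>S \<beta>\<close> from a lower \<open>S \<alpha>\<close>.\<close>

section \<open>Transfinite choice of points with disjoint sections\<close>

lemma countable_iff_card_of: "countable A \<longleftrightarrow> |A| \<le>o |UNIV :: nat set|"
  unfolding countable_def card_of_ordLeq[symmetric] by simp

text \<open>Well-order the indices in the type of their cardinal, so that each has fewer than
  \<open>|UNIV :: 'a set|\<close> predecessors. Their sections are countable by \<open>R1\<close>,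
  and each point in them rules out only countably many \<open>x\<close> by \<open>R2\<close>, so
  some \<open>x\<close> outside \<open>E i\<close> is left.\<close>

lemma disjoint_sections_choice:
  fixes R :: "'i \<Rightarrow> 'a \<Rightarrow> 'a set"
  assumes le: "|UNIV :: 'i set| \<le>o |UNIV :: 'a set|"
    and unc: "uncountable (UNIV :: 'a set)"
    and E: "\<And>i. countable (E i)"
    and R1: "\<And>i x. x \<notin> E i \<Longrightarrow> countable (R i x)"
    and R2: "\<And>i y. countable {x. y \<in> R i x}"
  shows "\<exists>a. (\<forall>i. a i \<notin> E i) \<and> (\<forall>i j. i \<noteq> j \<longrightarrow> R i (a i) \<inter> R j (a j) = {})"
proof -
  define r where "r = |UNIV :: 'i set|"
  have co: "Card_order r" unfolding r_def by (rule card_of_Card_order)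
  have F: "Field r = UNIV" unfolding r_def by (rule Field_card_of)
  have wo: "Well_order r" unfolding r_def by (rule card_of_Well_order)
  then have wf: "wf (r - Id)" unfolding well_order_on_def by blast
  define P where "P f i x \<longleftrightarrow> x \<notin> E i \<and> (\<forall>j. (j, i) \<in> r - Id \<longrightarrow> R j (f j) \<inter> R i x = {})"
    for f :: "'i \<Rightarrow> 'a" and i x
  have "\<exists>a. \<forall>i. P a i (a i)"
  proof (rule dependent_wf_choice[OF wf])
    show "P f x r' = P g x r'" if "\<And>z. (z, x) \<in> r - Id \<Longrightarrow> f z = g z" for f g x r'
      using that by (auto simp: P_def)
  next
    fix i f assume IH: "\<And>j. (j, i) \<in> r - Id \<Longrightarrow> P f j (f j)"
    define J where "J = underS r i"
    \<comment> \<open>The summand \<open>nat\<close> makes \<open>K\<close> infinite and a bound for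
      countable sets even if \<open>J\<close> is finite, while \<open>K\<close> stays smaller than
      the type \<open>'a\<close>.\<close>
    define K where "K = J <+> (UNIV :: nat set)"
    have infK: "infinite K" by (simp add: K_def)
    have cK: "|A| \<le>o |K|" if "countable A" for A :: "'a set"
    proof -
      have "|A| \<le>o |UNIV :: nat set|" using that by (simp only: countable_iff_card_of)
      moreover have "|UNIV :: nat set| \<le>o |K|" unfolding K_def by (rule card_of_Plus2)
      ultimately show ?thesis by (rule ordLeq_transitive)
    qed
    have "|J| <o r" using card_of_underS[OF co] F by (simp add: J_def)
    then have J: "|J| <o |UNIV :: 'a set|" using le ordLess_ordLeq_trans unfolding r_def by blast
    have N: "|UNIV :: nat set| <o |UNIV :: 'a set|"
      using unc by (simp only: countable_iff_card_of not_ordLeq_iff_ordLess card_of_Well_order)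
    have infU: "infinite (UNIV :: 'a set)" using unc countable_finite by blast
    have K: "|K| <o |UNIV :: 'a set|"
      unfolding K_def by (rule card_of_Plus_ordLess_infinite[OF infU J N])
    have JK: "|J| \<le>o |K|" unfolding K_def by (rule card_of_Plus1)
    define X where "X = (\<Union>j\<in>J. R j (f j))"
    have "|X| \<le>o |K|" unfolding X_def
    proof (rule card_of_UNION_ordLeq_infinite[OF infK JK], rule ballI)
      fix j assume "j \<in> J"
      then have "P f j (f j)" by (intro IH) (auto simp: J_def underS_def)
      then show "|R j (f j)| \<le>o |K|" by (intro cK R1) (simp add: P_def)
    qed
    then have "|\<Union>y\<in>X. {x. y \<in> R i x}| \<le>o |K|"
      by (rule card_of_UNION_ordLeq_infinite[OF infK]) (auto intro: cK R2)
    then have "|E i \<union> (\<Union>y\<in>X. {x. y \<in> R i x})| \<le>o |K|"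
      by (intro card_of_Un_ordLeq_infinite_Field[OF _ _ _ card_of_Card_order])
        (simp_all add: Field_card_of infK cK E)
    then have "|E i \<union> (\<Union>y\<in>X. {x. y \<in> R i x})| <o |UNIV :: 'a set|"
      using K ordLeq_ordLess_trans by blast
    then have "E i \<union> (\<Union>y\<in>X. {x. y \<in> R i x}) \<noteq> UNIV"
      using ordLess_irreflexive by fastforce
    then obtain x where "x \<notin> E i" "\<And>y. y \<in> X \<Longrightarrow> y \<notin> R i x" by auto
    then have "P f i x" by (auto simp: P_def X_def J_def underS_def)
    then show "\<exists>x. P f i x" ..
  qed
  then obtain a where a: "P a i (a i)" for i by blast
  have "(i, j) \<in> r - Id \<or> (j, i) \<in> r - Id" if "i \<noteq> j" for i j
    using wo that F by (auto simp: well_order_on_def linear_order_on_def total_on_def)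
  then have "R i (a i) \<inter> R j (a j) = {}" if "i \<noteq> j" for i j
    using a[of i] a[of j] that unfolding P_def by blast
  then show ?thesis using a unfolding P_def by blast
qed

section \<open>An almost disjoint family of infinite sets\<close>

text \<open>The shift by 2 keeps 0 and 1 out, so that characteristic functions of branches compose to 0.\<close>

definition branch_node :: "nat set \<Rightarrow> nat \<Rightarrow> nat" where
  "branch_node x n = prod_encode (n, set_encode (x \<inter> {..<n})) + 2"

text \<open>The codes of the initial segments of \<open>x\<close>, a path in the binary tree; the
  length \<open>n\<close> in the code separates the nodes even if \<open>x\<close> is
  finite.\<close>

definition branch :: "nat set \<Rightarrow> nat set" where
  "branch x = range (branch_node x)"

lemma infinite_branch: "infinite (branch x)"
  unfolding branch_def by (rule range_inj_infinite) (auto simp: inj_def branch_node_def)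

lemma branch_ge_2: "n \<in> branch x \<Longrightarrow> 2 \<le> n"
  by (auto simp: branch_def branch_node_def)

text \<open>A common node has one length \<open>n\<close> and equal restrictions to
  \<open>{..<n}\<close>, so \<open>n\<close> cannot exceed a point \<open>m\<close> at which
  \<open>x\<close> and \<open>y\<close> differ.\<close>

lemma finite_branch_Int:
  assumes "x \<noteq> y"
  shows "finite (branch x \<inter> branch y)"
proof -
  obtain m where m: "m \<in> x \<longleftrightarrow> m \<notin> y" using assms by blast
  have "branch x \<inter> branch y \<subseteq> branch_node x ` {..m}"
  proof
    fix k assume "k \<in> branch x \<inter> branch y"
    then obtain n where k: "k = branch_node x n" and "set_encode (x \<inter> {..<n}) = set_encode (y \<inter> {..<n})"
      by (auto simp: branch_def branch_node_def)
    then have "x \<inter> {..<n} = y \<inter> {..<n}" by (simp add: set_encode_eq)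
    then have "n \<le> m" using m by (metis IntD1 IntI lessThan_iff not_le)
    then show "k \<in> branch_node x ` {..m}" using k by auto
  qed
  then show ?thesis using finite_subset by blast
qed

lemma inj_branch: "inj branch"
proof (rule injI, rule ccontr)
  fix x y assume "branch x = branch y" "x \<noteq> y"
  then show False using finite_branch_Int[of x y] infinite_branch[of y] by simp
qed

text \<open>Preimages commute with intersections, so two different branches would make
  \<open>A\<close> the preimage of a finite set.\<close>

lemma vimage_branch_unique:
  assumes "c -` branch y = A" "c -` branch z = A" "\<And>F. finite F \<Longrightarrow> A \<noteq> c -` F"
  shows "y = z"
proof (rule ccontr)
  assume "y \<noteq> z"
  then have "finite (branch y \<inter> branch z)" by (rule finite_branch_Int)
  moreover have "A = c -` (branch y \<inter> branch z)" using assms by auto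
  ultimately show False using assms(3) by blast
qed

section \<open>Characteristic functions in generated semigroups\<close>

definition chi :: "nat set \<Rightarrow> nat \<Rightarrow> nat" where
  "chi A n = (if n \<in> A then 1 else 0)"

lemma inj_chi: "inj chi"
  by (rule injI) (auto simp: chi_def fun_eq_iff split: if_splits)

text \<open>Both 0 and 1 occur as values on the left and \<open>chi B\<close> has only these values,
  so \<open>u\<close> either fixes or swaps 0 and 1.\<close>

lemma chi_eq_comp_chi:
  assumes "chi A = u \<circ> chi B \<circ> c" "A \<noteq> {}" "A \<noteq> UNIV"
  shows "c -` B = A \<or> c -` B = - A"
proof -
  have *: "chi A n = u (chi B (c n))" for n using assms(1) by (metis comp_apply)
  obtain p q where p: "p \<in> A" and q: "q \<notin> A" using assms by blast
  have "u (chi B (c p)) = 1" "u (chi B (c q)) = 0"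
    using *[of p] *[of q] p q by (auto simp: chi_def)
  then have "u 1 = 1 \<and> u 0 = 0 \<or> u 1 = 0 \<and> u 0 = 1"
    by (auto simp: chi_def split: if_splits)
  then show ?thesis
  proof
    assume u: "u 1 = 1 \<and> u 0 = 0"
    have "n \<in> A \<longleftrightarrow> c n \<in> B" for n
      using *[of n] u by (cases "n \<in> A"; cases "c n \<in> B") (simp_all add: chi_def)
    then show ?thesis by auto
  next
    assume u: "u 1 = 0 \<and> u 0 = 1"
    have "n \<in> A \<longleftrightarrow> c n \<notin> B" for n
      using *[of n] u by (cases "n \<in> A"; cases "c n \<in> B") (simp_all add: chi_def)
    then show ?thesis by auto
  qed
qed

text \<open>Split a word at its last factor from \<open>V\<close>: what follows lies in
  \<open>M\<close>. The prefix \<open>u\<close> may be arbitrary, since only its effect on two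
  values matters later.\<close>

lemma semigroup_gen_Un_cases:
  assumes "f \<in> semigroup_gen (V \<union> C)"
    and C: "C \<subseteq> M" and id: "id \<in> M" and comp: "\<And>f g. f \<in> M \<Longrightarrow> g \<in> M \<Longrightarrow> f \<circ> g \<in> M"
  shows "f \<in> M \<or> (\<exists>u v c. v \<in> V \<and> c \<in> M \<and> f = u \<circ> v \<circ> c)"
  using assms(1)
proof induction
  case (gen_base f)
  then show ?case
  proof
    assume "f \<in> V"
    moreover have "f = id \<circ> f \<circ> id" by simp
    ultimately show ?thesis using id by blast
  qed (use C in blast)
next
  case (gen_comp f g)
  from gen_comp.IH(2) show ?case
  proof
    assume g: "g \<in> M"
    from gen_comp.IH(1) show ?thesis
    proof
      assume "\<exists>u v c. v \<in> V \<and> c \<in> M \<and> f = u \<circ> v \<circ> c"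
      then obtain u v c where "v \<in> V" "c \<in> M" "f = u \<circ> v \<circ> c" by blast
      moreover from this have "f \<circ> g = u \<circ> v \<circ> (c \<circ> g)" by (simp add: comp_assoc)
      ultimately show ?thesis using comp g by blast
    qed (use g comp in blast)
  next
    assume "\<exists>u v c. v \<in> V \<and> c \<in> M \<and> g = u \<circ> v \<circ> c"
    then obtain u v c where "v \<in> V" "c \<in> M" "g = u \<circ> v \<circ> c" by blast
    moreover from this have "f \<circ> g = (f \<circ> u) \<circ> v \<circ> c" by (simp add: comp_assoc)
    ultimately show ?thesis by blast
  qed
qed

lemma countable_monoid_superset:
  fixes C :: "('a \<Rightarrow> 'a) set"
  assumes "countable C"
  obtains M where "countable M" "C \<subseteq> M" "id \<in> M" "\<And>f g. f \<in> M \<Longrightarrow> g \<in> M \<Longrightarrow> f \<circ> g \<in> M"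
proof
  define eval where "eval fs = foldr (\<circ>) fs (id :: 'a \<Rightarrow> 'a)" for fs
  have app: "eval (fs @ gs) = eval fs \<circ> eval gs" for fs gs
    by (induction fs) (auto simp: eval_def comp_assoc)
  show "countable (eval ` lists C)" using assms by simp
  show "C \<subseteq> eval ` lists C"
  proof
    fix f assume "f \<in> C"
    then show "f \<in> eval ` lists C" by (intro image_eqI[of _ _ "[f]"]) (simp_all add: eval_def)
  qed
  show "id \<in> eval ` lists C" by (rule image_eqI[of _ _ "[]"]) (auto simp: eval_def)
  show "f \<circ> g \<in> eval ` lists C" if "f \<in> eval ` lists C" "g \<in> eval ` lists C" for f g
  proof -
    from that obtain fs gs where "fs \<in> lists C" "gs \<in> lists C" "f = eval fs" "g = eval gs"
      by (elim imageE)
    then show ?thesis by (intro image_eqI[of _ _ "fs @ gs"]) (simp_all add: app)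
  qed
qed

section \<open>Countable dependence between branches\<close>

text \<open>The \<open>y\<close> whose characteristic function may help \<open>M\<close> to generate
  that of \<open>branch x\<close>. Inserting \<open>x\<close> puts it into its own section for every
  \<open>M\<close>, with or without \<open>id\<close>.\<close>

definition derived :: "(nat \<Rightarrow> nat) set \<Rightarrow> nat set \<Rightarrow> nat set set" where
  "derived M x = insert x {y. \<exists>c\<in>M. c -` branch y = branch x \<or> c -` branch y = - branch x}"

text \<open>Here \<open>M\<close> already contains the function, or the uniqueness in
  \<open>vimage_branch_unique\<close> may fail.\<close>

definition exceptional :: "(nat \<Rightarrow> nat) set \<Rightarrow> nat set set" where
  "exceptional M = {x. chi (branch x) \<in> M \<or>
     (\<exists>c\<in>M. \<exists>F. finite F \<and> (branch x = c -` F \<or> - branch x = c -` F))}"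

lemma countable_vimage_inj:
  assumes "inj f" "countable A"
  shows "countable (f -` A)"
proof (rule countable_image_inj_on)
  show "countable (f ` (f -` A))" using assms(2) by (rule countable_subset[rotated]) auto
qed (use assms(1) in \<open>auto intro: inj_on_subset\<close>)

lemma countable_exceptional:
  assumes "countable M"
  shows "countable (exceptional M)"
proof -
  let ?\<F> = "Collect finite :: nat set set"
  let ?D = "(\<lambda>(c, F). c -` F) ` (M \<times> ?\<F>)"
  have D: "countable ?D"
    using assms countable_Collect_finite by blast
  have "inj (\<lambda>x. chi (branch x))" "inj (\<lambda>x. - branch x)"
    using inj_chi inj_branch by (auto simp: inj_def)
  then have "countable ((\<lambda>x. chi (branch x)) -` M)" "countable (branch -` ?D)"
    "countable ((\<lambda>x. - branch x) -` ?D)"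
    using assms D inj_branch by (simp_all only: countable_vimage_inj)
  moreover have "exceptional M \<subseteq> (\<lambda>x. chi (branch x)) -` M \<union> branch -` ?D \<union> (\<lambda>x. - branch x) -` ?D"
    by (auto simp: exceptional_def)
  ultimately show ?thesis by (meson countable_Un countable_subset)
qed

text \<open>Outside the exceptional set, each \<open>c\<close> in \<open>M\<close> admits at most
  one \<open>y\<close> for \<open>branch x\<close> and one for its complement.\<close>

lemma countable_derived:
  assumes "countable M" "x \<notin> exceptional M"
  shows "countable (derived M x)"
proof -
  have *: "countable {y. c -` branch y = A}" if "\<And>F. finite F \<Longrightarrow> A \<noteq> c -` F" for c :: "nat \<Rightarrow> nat" and A
  proof (cases "{y. c -` branch y = A} = {}")
    case False
    then obtain y where "c -` branch y = A" by blast
    then have "{y. c -` branch y = A} \<subseteq> {y}"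
      using vimage_branch_unique[of c _ A y] that by blast
    then show ?thesis by (rule countable_subset) simp
  qed simp
  have "derived M x \<subseteq>
      insert x (\<Union>c\<in>M. {y. c -` branch y = branch x} \<union> {y. c -` branch y = - branch x})"
    by (auto simp: derived_def)
  moreover have "countable \<dots>"
    by (intro countable_insert countable_UN countable_Un * assms(1))
      (use assms(2) in \<open>auto simp: exceptional_def\<close>)
  ultimately show ?thesis by (rule countable_subset)
qed

text \<open>Now \<open>y\<close> and \<open>c\<close> determine \<open>branch x\<close> up to
  complement, and \<open>branch\<close> is injective.\<close>

lemma countable_derived_converse:
  assumes "countable M"
  shows "countable {x. y \<in> derived M x}"
proof -
  let ?D = "(\<lambda>c. c -` branch y) ` M \<union> (\<lambda>c. - (c -` branch y)) ` M"
  have "countable (branch -` ?D)"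
    using assms by (intro countable_vimage_inj inj_branch) simp
  then have "countable (insert y (branch -` ?D))" by (rule countable_insert)
  moreover have "{x. y \<in> derived M x} \<subseteq> insert y (branch -` ?D)"
  proof
    fix x assume "x \<in> {x. y \<in> derived M x}"
    then have "x = y \<or> (\<exists>c\<in>M. c -` branch y = branch x \<or> c -` branch y = - branch x)"
      unfolding derived_def by blast
    then consider "x = y" | c where "c \<in> M" "c -` branch y = branch x"
      | c where "c \<in> M" "c -` branch y = - branch x"
      by blast
    then show "x \<in> insert y (branch -` ?D)"
    proof cases
      case 3
      then have "branch x = - (c -` branch y)" by simp
      then show ?thesis using 3(1) by (intro insertI2 vimageI2 UnI2) (rule image_eqI)
    next
      case 2
      then show ?thesis by (intro insertI2 vimageI2 UnI1) (rule image_eqI[OF sym])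
    qed simp
  qed
  ultimately show ?thesis by (rule countable_subset[rotated])
qed

text \<open>The pairs index the recursion: a level, and an enumeration whose range is a countable
  set of maps. The code is the disjoint sum of the level and the graph of the enumeration.\<close>

lemma card_of_pairs_le:
  "|UNIV :: (nat set \<times> (nat \<Rightarrow> nat \<Rightarrow> nat)) set| \<le>o |UNIV :: nat set set|"
proof -
  define code where "code = (\<lambda>(\<alpha> :: nat set, e :: nat \<Rightarrow> nat \<Rightarrow> nat).
    sum_encode ` (\<alpha> <+> (\<lambda>(n, m). prod_encode (n, prod_encode (m, e n m))) ` UNIV))"
  have "inj code"
  proof (rule injI, clarify)
    fix \<alpha> \<beta> e e' assume "code (\<alpha>, e) = code (\<beta>, e')"
    then have eq: "\<alpha> <+> (\<lambda>(n, m). prod_encode (n, prod_encode (m, e n m))) ` UNIV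
      = \<beta> <+> (\<lambda>(n, m). prod_encode (n, prod_encode (m, e' n m))) ` UNIV"
      by (simp add: code_def inj_image_eq_iff[OF inj_sum_encode])
    have "k \<in> \<alpha> \<longleftrightarrow> k \<in> \<beta>" for k using arg_cong[OF eq, of "\<lambda>S. Inl k \<in> S"] by auto
    moreover have "e n m = e' n m" for n m
      using arg_cong[OF eq, of "\<lambda>S. Inr (prod_encode (n, prod_encode (m, e n m))) \<in> S"]
      by (auto simp: image_iff)
    ultimately show "\<alpha> = \<beta> \<and> e = e'" by (auto simp: fun_eq_iff)
  qed
  then show ?thesis using card_of_ordLeq by blast
qed

lemma uncountable_nat_set: "uncountable (UNIV :: nat set set)"
proof
  assume "countable (UNIV :: nat set set)"
  then obtain f :: "nat \<Rightarrow> nat set" where "surj f"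
    by (metis UNIV_not_empty range_from_nat_into)
  then show False using Cantors_theorem[of "UNIV :: nat set"] by auto
qed

theorem theorem6p1:
  shows "\<exists>S :: nat set \<Rightarrow> (nat \<Rightarrow> nat) set.
    (\<forall>\<alpha> \<in> Field aleph1. subsemigroup (S \<alpha>) \<and> S \<alpha> \<subseteq> F2) \<and>
    (\<forall>\<alpha> \<in> Field aleph1. \<forall>\<beta> \<in> Field aleph1.
       (\<alpha>, \<beta>) \<in> aleph1 \<and> \<alpha> \<noteq> \<beta> \<longrightarrow> strict_prec (S \<alpha>) (S \<beta>))"
proof -
  have "\<exists>a. (\<forall>i :: nat set \<times> (nat \<Rightarrow> nat \<Rightarrow> nat). a i \<notin> exceptional (range (snd i))) \<and>
    (\<forall>i j. i \<noteq> j \<longrightarrow> derived (range (snd i)) (a i) \<inter> derived (range (snd j)) (a j) = {})"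
    by (rule disjoint_sections_choice[OF card_of_pairs_le uncountable_nat_set])
      (auto intro: countable_exceptional countable_derived countable_derived_converse)
  then obtain a :: "nat set \<times> (nat \<Rightarrow> nat \<Rightarrow> nat) \<Rightarrow> nat set"
    where a: "\<And>i. a i \<notin> exceptional (range (snd i))"
      and disj: "\<And>i j. i \<noteq> j \<Longrightarrow> derived (range (snd i)) (a i) \<inter> derived (range (snd j)) (a j) = {}"
    by blast
  define level where "level \<alpha> = (\<Union>e. derived (range e) (a (\<alpha>, e)))" for \<alpha>
  \<comment> \<open>The function \<open>chi {}\<close> is constantly 0, the value of every product
    in \<open>S \<alpha>\<close>.\<close>
  define S where "S \<alpha> = insert (chi {}) {chi (branch y) | y \<beta>. (\<beta>, \<alpha>) \<in> aleph1 \<and> y \<in> level \<beta>}" for \<alpha>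
  have "Card_order aleph1"
    unfolding aleph1_def by (simp add: cardSuc_Card_order natLeq_Card_order)
  then have lin: "Linear_order aleph1"
    by (simp add: card_order_on_def well_order_on_def)
  then have refl: "(\<alpha>, \<alpha>) \<in> aleph1" if "\<alpha> \<in> Field aleph1" for \<alpha>
    using that by (auto simp: order_on_defs refl_on_def)
  have trans: "trans aleph1" and antisym: "antisym aleph1"
    using lin by (auto simp: order_on_defs)
  have S_chi: "\<exists>A. f = chi A \<and> A \<inter> {0, 1} = {}" if "f \<in> S \<alpha>" for f \<alpha>
    using that branch_ge_2 unfolding S_def by fastforce
  have comp_S: "f \<circ> g = chi {}" if "f \<in> S \<alpha>" "g \<in> S \<alpha>" for f g \<alpha>
    using S_chi[OF that(1)] S_chi[OF that(2)] by (auto simp: chi_def fun_eq_iff)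
  have sub: "subsemigroup (S \<alpha>)" for \<alpha>
    unfolding subsemigroup_def using comp_S by (auto simp: S_def)
  have F2: "S \<alpha> \<subseteq> F2" for \<alpha>
  proof
    fix f assume "f \<in> S \<alpha>"
    then have r: "range f \<subseteq> {0, 1}" using S_chi[of f \<alpha>] by (auto simp: chi_def split: if_splits)
    then have "finite (range f)" by (rule finite_subset) simp
    moreover have "card (range f) \<le> card {0, 1 :: nat}" using r by (intro card_mono) auto
    ultimately show "f \<in> F2" by (simp add: F2_def)
  qed
  have strict: "strict_prec (S \<alpha>) (S \<beta>)"
    if \<beta>: "\<beta> \<in> Field aleph1" and le: "(\<alpha>, \<beta>) \<in> aleph1" and ne: "\<alpha> \<noteq> \<beta>" for \<alpha> \<beta>
  proof -
    have "S \<alpha> \<subseteq> S \<beta>" using transD[OF trans _ le] by (auto simp: S_def)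
    then have "preceq (S \<alpha>) (S \<beta>)"
      unfolding preceq_def by (intro exI[of _ "{}"]) (auto intro: gen_base)
    moreover have "\<not> preceq (S \<beta>) (S \<alpha>)"
    proof
      assume "preceq (S \<beta>) (S \<alpha>)"
      then obtain C where "countable C" and C: "S \<beta> \<subseteq> semigroup_gen (S \<alpha> \<union> C)"
        by (auto simp: preceq_def)
      from \<open>countable C\<close> obtain M where M: "countable M" "C \<subseteq> M" "id \<in> M"
        "\<And>f g. f \<in> M \<Longrightarrow> g \<in> M \<Longrightarrow> f \<circ> g \<in> M"
        by (rule countable_monoid_superset) blast
      \<comment> \<open>As \<open>M\<close> contains \<open>id\<close>, it is nonempty and thus the
        range of \<open>e\<close>; the point chosen for \<open>(\<beta>, e)\<close> is the
        witness.\<close>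
      define e where "e = from_nat_into M"
      have e: "range e = M" unfolding e_def using M by (intro range_from_nat_into) auto
      define x where "x = a (\<beta>, e)"
      have x: "x \<notin> exceptional M" using a[of "(\<beta>, e)"] e by (simp add: x_def)
      have "x \<in> level \<beta>" by (auto simp: level_def x_def derived_def)
      then have "chi (branch x) \<in> S \<beta>" using refl[OF \<beta>] by (auto simp: S_def)
      then have "chi (branch x) \<in> semigroup_gen (S \<alpha> \<union> C)" using C by blast
      then have "chi (branch x) \<in> M \<or> (\<exists>u v c. v \<in> S \<alpha> \<and> c \<in> M \<and> chi (branch x) = u \<circ> v \<circ> c)"
        using M(2-4) by (rule semigroup_gen_Un_cases)
      then obtain u v c where v: "v \<in> S \<alpha>" and c: "c \<in> M" and eq: "chi (branch x) = u \<circ> v \<circ> c"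
        using x by (auto simp: exceptional_def)
      have nontriv: "branch x \<noteq> {}" "branch x \<noteq> UNIV"
        using infinite_branch[of x] branch_ge_2[of 0 x] by auto
      \<comment> \<open>A constant middle factor would force \<open>branch x\<close> to be empty or
        everything.\<close>
      have "v \<noteq> chi {}"
        using chi_eq_comp_chi[of "branch x" u "{}" c] eq nontriv by auto
      then obtain y \<gamma> where vy: "v = chi (branch y)" and \<gamma>: "(\<gamma>, \<alpha>) \<in> aleph1" and y: "y \<in> level \<gamma>"
        using v by (auto simp: S_def)
      have "c -` branch y = branch x \<or> c -` branch y = - branch x"
        using eq nontriv unfolding vy by (rule chi_eq_comp_chi)
      then have "y \<in> derived M x" using c by (auto simp: derived_def)
      then have y1: "y \<in> derived (range (snd (\<beta>, e))) (a (\<beta>, e))" using e by (simp add: x_def)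
      obtain e' where y2: "y \<in> derived (range (snd (\<gamma>, e'))) (a (\<gamma>, e'))"
        using y by (auto simp: level_def)
      \<comment> \<open>Since \<open>\<gamma>\<close> is at most \<open>\<alpha>\<close>, it is
        strictly below \<open>\<beta>\<close>, so \<open>y\<close> lies in the sections of two
        distinct indices.\<close>
      have "\<gamma> \<noteq> \<beta>" using \<gamma> le ne antisym by (auto dest: antisymD)
      then show False using disj[of "(\<beta>, e)" "(\<gamma>, e')"] y1 y2 by blast
    qed
    ultimately show ?thesis by (simp add: strict_prec_def approx_def)
  qed
  show ?thesis using sub F2 strict by blast
qed

end
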